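(* Let $A$ be a finite-dimensional vector space over $\mathbb{C}$ with two bilinear operations $\circ,\ast: A\otimes A\to A$ such that $(A,\circ)$ and $(A,\ast)$ are anti-pre-Lie algebras. Then $(A,\circ,\ast)$ is a compatible anti-pre-Lie algebra if and only if $(A,\circ,\ast)$ is a compatible Lie-admissible algebra and $(-\mathcal{L}_{\circ},-\mathcal{L}_{\ast},A)$ is a representation of the compatible Lie algebra $(A,[-,-]_1,[-,-]_2)$, where $[x,y]_1=x\circ y-y\circ x$ and $[x,y]_2=x\ast y-y\ast x$.
   Context: All vector spaces and algebras are finite-dimensional over $\mathbb{C}$. An anti-pre-Lie algebra is a vector space $A$ with a bilinear operation $\cdot$ such that, with $[x,y]=x\cdot y-y\cdot x$, for all $x,y,z\in A$: $x\cdot(y\cdot z)-y\cdot(x\cdot z)=[y,x]\cdot z$ and $[x,y]\cdot z+[y,z]\cdot x+[z,x]\cdot y=0$. Two anti-pre-Lie algebras $(A,\circ)$, $(A,\ast)$ on the same vector space are compatible, and $(A,\circ,\ast)$ is called a compatible anti-pre-Lie algebra, if for all $k_1,k_2\in\mathbb{C}$ the operation $x\star y=k_1x\circ y+k_2x\ast y$ makes $A$ an anti-pre-Lie algebra. A compatible Lie algebra $(\mathfrak{g},[-,-]_1,[-,-]_2)$ is a vector space with two Lie brackets such that $k_1[-,-]_1+k_2[-,-]_2$ is a Lie bracket for all $k_1,k_2\in\mathbb{C}$. A representation $(\rho,\mu,V)$ of it is a vector space $V$ with linear maps $\rho,\mu:\mathfrak{g}\to\mathfrak{gl}(V)$ such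 that for all $k_1,k_2\in\mathbb{C}$, $k_1\rho+k_2\mu$ is a representation of the Lie algebra $(\mathfrak{g},k_1[-,-]_1+k_2[-,-]_2)$. A vector space with two bilinear operations $(A,\circ,\ast)$ is a compatible Lie-admissible algebra if the commutators $[x,y]_1=x\circ y-y\circ x$ and $[x,y]_2=x\ast y-y\ast x$ make $(A,[-,-]_1,[-,-]_2)$ a compatible Lie algebra. The left multiplication operators are $\mathcal{L}_{\circ}(x)y=x\circ y$ and $\mathcal{L}_{\ast}(x)y=x\ast y$. *)

theory Defs
  imports Complex_Main
begin

text \<open>
  Complex vector spaces are given by an explicit scalar multiplication
  \<open>scale\<close> on an additive group, with the library locale \<^locale>\<open>vector_space\<close>.
  The definitions below do not demand finite dimension; where it is wanted it is
  assumed separately through \<^locale>\<open>finite_dimensional_vector_space\<close>.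
\<close>

definition bilinear_map ::
  "(complex \<Rightarrow> 'a \<Rightarrow> 'a) \<Rightarrow> (complex \<Rightarrow> 'b \<Rightarrow> 'b) \<Rightarrow> (complex \<Rightarrow> 'c \<Rightarrow> 'c)
    \<Rightarrow> ('a::ab_group_add \<Rightarrow> 'b::ab_group_add \<Rightarrow> 'c::ab_group_add) \<Rightarrow> bool" where
  "bilinear_map sA sB sC f \<longleftrightarrow>
     (\<forall>x. Vector_Spaces.linear sB sC (\<lambda>y. f x y)) \<and>
     (\<forall>y. Vector_Spaces.linear sA sC (\<lambda>x. f x y))"

definition lin_comb ::
  "(complex \<Rightarrow> 'c \<Rightarrow> 'c) \<Rightarrow> complex \<Rightarrow> complex \<Rightarrow> ('a \<Rightarrow> 'b \<Rightarrow> 'c::ab_group_add)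
    \<Rightarrow> ('a \<Rightarrow> 'b \<Rightarrow> 'c) \<Rightarrow> 'a \<Rightarrow> 'b \<Rightarrow> 'c" where
  "lin_comb scale k1 k2 f g = (\<lambda>x y. scale k1 (f x y) + scale k2 (g x y))"

definition commutator :: "('a \<Rightarrow> 'a \<Rightarrow> 'a::ab_group_add) \<Rightarrow> 'a \<Rightarrow> 'a \<Rightarrow> 'a" where
  "commutator m = (\<lambda>x y. m x y - m y x)"

definition left_mult :: "('a \<Rightarrow> 'a \<Rightarrow> 'a) \<Rightarrow> 'a \<Rightarrow> 'a \<Rightarrow> 'a" where
  "left_mult m = (\<lambda>x. \<lambda>y. m x y)"

locale anti_pre_Lie_algebra = vector_space scale
  for scale :: "complex \<Rightarrow> 'a::ab_group_add \<Rightarrow> 'a" +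
  fixes m :: "'a \<Rightarrow> 'a \<Rightarrow> 'a"
  assumes bilinear: "bilinear_map scale scale scale m"
    and left_mult_commutator:
      "m x (m y z) - m y (m x z) = m (commutator m y x) z"
    and commutator_cyclic:
      "m (commutator m x y) z + m (commutator m y z) x + m (commutator m z x) y = 0"

definition compatible_anti_pre_Lie_algebra ::
  "(complex \<Rightarrow> 'a \<Rightarrow> 'a) \<Rightarrow> ('a \<Rightarrow> 'a \<Rightarrow> 'a) \<Rightarrow> ('a \<Rightarrow> 'a \<Rightarrow> 'a::ab_group_add) \<Rightarrow> bool" where
  "compatible_anti_pre_Lie_algebra scale m1 m2 \<longleftrightarrow>
     anti_pre_Lie_algebra scale m1 \<and> anti_pre_Lie_algebra scale m2 \<and>
     (\<forall>k1 k2. anti_pre_Lie_algebra scale (lin_comb scale k1 k2 m1 m2))"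

locale Lie_algebra = vector_space scale
  for scale :: "complex \<Rightarrow> 'a::ab_group_add \<Rightarrow> 'a" +
  fixes br :: "'a \<Rightarrow> 'a \<Rightarrow> 'a"
  assumes bilinear: "bilinear_map scale scale scale br"
    and alternating: "br x x = 0"
    and Jacobi: "br x (br y z) + br y (br z x) + br z (br x y) = 0"

definition compatible_Lie_algebra ::
  "(complex \<Rightarrow> 'a \<Rightarrow> 'a) \<Rightarrow> ('a \<Rightarrow> 'a \<Rightarrow> 'a) \<Rightarrow> ('a \<Rightarrow> 'a \<Rightarrow> 'a::ab_group_add) \<Rightarrow> bool" where
  "compatible_Lie_algebra scale br1 br2 \<longleftrightarrow>
     Lie_algebra scale br1 \<and> Lie_algebra scale br2 \<and>
     (\<forall>k1 k2. Lie_algebra scale (lin_comb scale k1 k2 br1 br2))"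

definition compatible_Lie_admissible_algebra ::
  "(complex \<Rightarrow> 'a \<Rightarrow> 'a) \<Rightarrow> ('a \<Rightarrow> 'a \<Rightarrow> 'a) \<Rightarrow> ('a \<Rightarrow> 'a \<Rightarrow> 'a::ab_group_add) \<Rightarrow> bool" where
  "compatible_Lie_admissible_algebra scale m1 m2 \<longleftrightarrow>
     bilinear_map scale scale scale m1 \<and> bilinear_map scale scale scale m2 \<and>
     compatible_Lie_algebra scale (commutator m1) (commutator m2)"

text \<open>
  A linear map \<open>\<rho>\<close> from \<open>\<gg>\<close> to \<open>gl(V)\<close> is curried, \<open>\<rho> x v\<close>; since the vector space
  operations of \<open>gl(V)\<close> are pointwise, such a map is the same thing as a bilinear map
  from \<open>\<gg> \<times> V\<close> to \<open>V\<close>: linearity in \<open>v\<close> says that \<open>\<rho> x\<close> is in \<open>gl(V)\<close>, and linearity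
  in \<open>x\<close> that \<open>\<rho>\<close> is linear.
\<close>

locale Lie_algebra_representation =
  Lie_algebra scaleg br + V: vector_space scaleV
  for scaleg :: "complex \<Rightarrow> 'g::ab_group_add \<Rightarrow> 'g"
    and br :: "'g \<Rightarrow> 'g \<Rightarrow> 'g"
    and scaleV :: "complex \<Rightarrow> 'v::ab_group_add \<Rightarrow> 'v" +
  fixes \<rho> :: "'g \<Rightarrow> 'v \<Rightarrow> 'v"
  assumes linear_to_gl: "bilinear_map scaleg scaleV scaleV \<rho>"
    and bracket: "\<rho> (br x y) v = \<rho> x (\<rho> y v) - \<rho> y (\<rho> x v)"

definition compatible_Lie_algebra_representation ::
  "(complex \<Rightarrow> 'g \<Rightarrow> 'g) \<Rightarrow> ('g \<Rightarrow> 'g \<Rightarrow> 'g) \<Rightarrow> ('g \<Rightarrow> 'g \<Rightarrow> 'g::ab_group_add)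
    \<Rightarrow> (complex \<Rightarrow> 'v \<Rightarrow> 'v) \<Rightarrow> ('g \<Rightarrow> 'v \<Rightarrow> 'v) \<Rightarrow> ('g \<Rightarrow> 'v \<Rightarrow> 'v::ab_group_add) \<Rightarrow> bool" where
  "compatible_Lie_algebra_representation scaleg br1 br2 scaleV \<rho> \<mu> \<longleftrightarrow>
     compatible_Lie_algebra scaleg br1 br2 \<and> vector_space scaleV \<and>
     bilinear_map scaleg scaleV scaleV \<rho> \<and> bilinear_map scaleg scaleV scaleV \<mu> \<and>
     (\<forall>k1 k2. Lie_algebra_representation scaleg (lin_comb scaleg k1 k2 br1 br2)
                scaleV (lin_comb scaleV k1 k2 \<rho> \<mu>))"

end

theory Submission
  imports Defs
begin

text \<open>
  Compatibility on either side is a statement about every operation \<open>k1 m1 + k2 m2\<close> of the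
  pencil spanned by \<open>m1\<close> and \<open>m2\<close>, so the theorem is the pencil version of a fact about one
  bilinear operation \<open>m\<close>: it is anti-pre-Lie if and only if its commutator is a Lie bracket which
  the negated left multiplications represent
  (\<open>anti_pre_Lie_iff_neg_left_mult_representation\<close>).  The transfer works because forming the
  commutator and negating left multiplications are both linear in \<open>m\<close>, hence commute with taking
  linear combinations.

  For the single operation, the representation identity
  \<open>- m [x, y] z = m x (m y z) - m y (m x z)\<close> is the first anti-pre-Lie axiom.  Given that axiom,
  the terms of the Jacobi sum in which a bracket stands on the right can be traded for terms in
  which it stands on the left, and the Jacobi sum becomes \<open>-2\<close> times the cyclic sum of
  \<open>m [x, y] z\<close> (\<open>Jacobi_sum_commutator\<close>).  Over the complex numbers the factor can be cancelled,
  so the Jacobi identity and the second anti-pre-Lie axiom are equivalent.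
\<close>

lemma bilinear_mapD:
  assumes "bilinear_map sA sB sC f"
  shows bilinear_map_diff_left: "f (x - x') y = f x y - f x' y"
    and bilinear_map_diff_right: "f x (y - y') = f x y - f x y'"
    and bilinear_map_minus_right: "f x (- y) = - f x y"
proof -
  interpret r: Vector_Spaces.linear sB sC "\<lambda>y. f x y" for x
    using assms by (simp add: bilinear_map_def)
  interpret l: Vector_Spaces.linear sA sC "\<lambda>x. f x y" for y
    using assms by (simp add: bilinear_map_def)
  show "f (x - x') y = f x y - f x' y" "f x (y - y') = f x y - f x y'"
    "f x (- y) = - f x y"
    by (simp_all add: l.diff r.diff r.neg)
qed

lemma bilinear_map_lin_comb:
  assumes "bilinear_map sA sB sC f" and "bilinear_map sA sB sC g"
  shows "bilinear_map sA sB sC (lin_comb sC k1 k2 f g)"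
proof -
  have vs: "vector_space sA" "vector_space sB" "vector_space sC"
    using assms(1) by (auto simp: bilinear_map_def Vector_Spaces.linear_def)
  interpret AC: vector_space_pair sA sC
    using vs by (simp add: vector_space_pair_def)
  interpret BC: vector_space_pair sB sC
    using vs by (simp add: vector_space_pair_def)
  show ?thesis
    using assms unfolding bilinear_map_def lin_comb_def
    by (auto intro!: AC.linear_compose_add AC.linear_compose_scale_right
        BC.linear_compose_add BC.linear_compose_scale_right)
qed

lemma bilinear_map_minus:
  assumes "bilinear_map sA sB sC f"
  shows "bilinear_map sA sB sC (\<lambda>x y. - f x y)"
proof -
  have vs: "vector_space sA" "vector_space sB" "vector_space sC"
    using assms by (auto simp: bilinear_map_def Vector_Spaces.linear_def)
  interpret AC: vector_space_pair sA sC
    using vs by (simp add: vector_space_pair_def)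
  interpret BC: vector_space_pair sB sC
    using vs by (simp add: vector_space_pair_def)
  show ?thesis
    using assms unfolding bilinear_map_def
    by (auto intro!: AC.linear_compose_neg BC.linear_compose_neg)
qed

lemma bilinear_map_commutator:
  assumes "bilinear_map s s s m"
  shows "bilinear_map s s s (commutator m)"
proof -
  have "vector_space s"
    using assms by (auto simp: bilinear_map_def Vector_Spaces.linear_def)
  then interpret vector_space_pair s s
    by (simp add: vector_space_pair_def)
  show ?thesis
    using assms unfolding bilinear_map_def commutator_def
    by (auto intro!: linear_compose_sub)
qed

lemma commutator_lin_comb:
  assumes "vector_space scale"
  shows "commutator (lin_comb scale k1 k2 m1 m2)
    = lin_comb scale k1 k2 (commutator m1) (commutator m2)"
proof -
  interpret vector_space scale by fact
  show ?thesis
    by (intro ext) (simp add: commutator_def lin_comb_def scale_right_diff_distrib)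
qed

lemma minus_lin_comb:
  assumes "vector_space scale"
  shows "lin_comb scale k1 k2 (\<lambda>x y. - f x y) (\<lambda>x y. - g x y)
    = (\<lambda>x y. - lin_comb scale k1 k2 f g x y)"
proof -
  interpret vector_space scale by fact
  show ?thesis
    by (intro ext) (simp add: lin_comb_def)
qed

lemma
  assumes "vector_space scale"
  shows lin_comb_1_0: "lin_comb scale 1 0 f g = f"
    and lin_comb_0_1: "lin_comb scale 0 1 f g = g"
proof -
  interpret vector_space scale by fact
  show "lin_comb scale 1 0 f g = f" "lin_comb scale 0 1 f g = g"
    by (simp_all add: lin_comb_def)
qed

text \<open>
  Expanding the outer brackets gives the terms \<open>m x [y, z]\<close>, whose cyclic sum regroups into the
  differences \<open>m x (m y z) - m y (m x z)\<close>; by the first anti-pre-Lie axiom these are again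
  products with a bracket on the left.  They double the remaining terms \<open>- m [y, z] x\<close>
  instead of cancelling them, in contrast to the case of pre-Lie algebras.
\<close>

lemma Jacobi_sum_commutator:
  fixes m :: "'a \<Rightarrow> 'a \<Rightarrow> 'a::ab_group_add"
  defines "c \<equiv> commutator m"
  assumes bil: "bilinear_map s s s m"
    and left: "\<And>x y z. m x (m y z) - m y (m x z) = m (c y x) z"
  shows "c x (c y z) + c y (c z x) + c z (c x y)
    = - ((m (c x y) z + m (c y z) x + m (c z x) y)
       + (m (c x y) z + m (c y z) x + m (c z x) y))"
proof -
  have skew: "m (c a b) d = - m (c b a) d" for a b d
    by (simp add: c_def commutator_def bilinear_mapD[OF bil])
  have outer: "c a (c b d) = m a (m b d) - m a (m d b) - m (c b d) a" for a b d
    by (simp add: c_def commutator_def bilinear_mapD[OF bil])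
  have "c x (c y z) + c y (c z x) + c z (c x y)
      = (m x (m y z) - m y (m x z)) + (m y (m z x) - m z (m y x)) + (m z (m x y) - m x (m z y))
        - (m (c x y) z + m (c y z) x + m (c z x) y)"
    by (simp add: outer algebra_simps)
  also have "\<dots> = - ((m (c x y) z + m (c y z) x + m (c z x) y)
      + (m (c x y) z + m (c y z) x + m (c z x) y))"
    by (simp add: left skew[of y x] skew[of z y] skew[of x z] algebra_simps)
  finally show ?thesis .
qed

lemma (in vector_space) double_eq_0_iff:
  fixes v :: 'b
  assumes "(2 :: 'a) \<noteq> 0"
  shows "v + v = 0 \<longleftrightarrow> v = 0"
proof -
  have "v + v = 2 *s v"
    by (metis one_add_one scale_left_distrib scale_one)
  then show ?thesis
    using assms by simp
qed

theorem anti_pre_Lie_iff_neg_left_mult_representation: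
  assumes bil: "bilinear_map scale scale scale m"
  shows "anti_pre_Lie_algebra scale m
    \<longleftrightarrow> Lie_algebra_representation scale (commutator m) scale (\<lambda>x y. - m x y)"
    (is "?anti \<longleftrightarrow> ?rep")
proof -
  have vs: "vector_space scale"
    using bil by (auto simp: bilinear_map_def Vector_Spaces.linear_def)
  interpret vector_space scale by (fact vs)
  let ?c = "commutator m"
  have skew: "m (?c a b) d = - m (?c b a) d" for a b d
    by (simp add: commutator_def bilinear_mapD[OF bil])
  show ?thesis
  proof
    assume ?anti
    then interpret anti_pre_Lie_algebra scale m .
    have "?c x (?c y z) + ?c y (?c z x) + ?c z (?c x y) = 0" for x y z
      by (simp add: Jacobi_sum_commutator[OF bil left_mult_commutator] commutator_cyclic)
    moreover have "- m (?c x y) v = m x (m y v) - m y (m x v)" for x y v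
      using left_mult_commutator[of x y v] skew[of y x v] by simp
    moreover have "?c x x = 0" for x
      by (simp add: commutator_def)
    ultimately show ?rep
      by unfold_locales
        (simp_all add: bilinear_map_commutator bil bilinear_map_minus bilinear_mapD[OF bil])
  next
    assume ?rep
    then interpret rep: Lie_algebra_representation scale ?c scale "\<lambda>x y. - m x y" .
    have left: "m x (m y z) - m y (m x z) = m (?c y x) z" for x y z
      using rep.bracket[of x y z] skew[of y x z] by (simp add: bilinear_mapD[OF bil])
    have "m (?c x y) z + m (?c y z) x + m (?c z x) y = 0" for x y z
      using rep.Jacobi[of x y z] Jacobi_sum_commutator[OF bil left, of x y z]
      by (simp only: neg_equal_0_iff_equal double_eq_0_iff[OF zero_neq_numeral[symmetric]])
    then show ?anti
      by unfold_locales (simp_all add: bil left)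
  qed
qed

theorem proposition2p12:
  fixes scale :: "complex \<Rightarrow> 'a::ab_group_add \<Rightarrow> 'a"
    and B :: "'a set"
    and m1 m2 :: "'a \<Rightarrow> 'a \<Rightarrow> 'a"
  assumes "finite_dimensional_vector_space scale B"
    and "anti_pre_Lie_algebra scale m1"
    and "anti_pre_Lie_algebra scale m2"
  shows "compatible_anti_pre_Lie_algebra scale m1 m2 \<longleftrightarrow>
    compatible_Lie_admissible_algebra scale m1 m2 \<and>
    compatible_Lie_algebra_representation scale (commutator m1) (commutator m2)
      scale (\<lambda>x y. - left_mult m1 x y) (\<lambda>x y. - left_mult m2 x y)"
proof -
  have bil1: "bilinear_map scale scale scale m1" and bil2: "bilinear_map scale scale scale m2"
    using assms(2,3) by (simp_all add: anti_pre_Lie_algebra.bilinear)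
  interpret vector_space scale
    using assms(2) by (simp add: anti_pre_Lie_algebra_def)
  have pencil: "anti_pre_Lie_algebra scale (lin_comb scale k1 k2 m1 m2) \<longleftrightarrow>
      Lie_algebra_representation scale (lin_comb scale k1 k2 (commutator m1) (commutator m2))
        scale (lin_comb scale k1 k2 (\<lambda>x y. - m1 x y) (\<lambda>x y. - m2 x y))" for k1 k2
    using anti_pre_Lie_iff_neg_left_mult_representation[OF bilinear_map_lin_comb[OF bil1 bil2]]
    by (simp only: commutator_lin_comb[OF vector_space_axioms]
        minus_lin_comb[OF vector_space_axioms])
  let ?Lie = "\<lambda>k1 k2. Lie_algebra scale (lin_comb scale k1 k2 (commutator m1) (commutator m2))"
  have Lie: "compatible_Lie_algebra scale (commutator m1) (commutator m2) \<longleftrightarrow> (\<forall>k1 k2. ?Lie k1 k2)"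
    unfolding compatible_Lie_algebra_def by (metis lin_comb_1_0[OF vector_space_axioms] lin_comb_0_1[OF vector_space_axioms])
  show ?thesis
    unfolding compatible_anti_pre_Lie_algebra_def compatible_Lie_admissible_algebra_def
      compatible_Lie_algebra_representation_def left_mult_def Lie pencil
    using assms(2,3) bil1 bil2 bilinear_map_minus[OF bil1] bilinear_map_minus[OF bil2]
      vector_space_axioms Lie_algebra_representation.axioms(1)
    by blast
qed

end
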